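(* Let $\epsilon>0$ be given, and let $\{x_t,p_t\}_{t=1}^{\tilde T}$ be a sequence generated by the stochastic distributionally robust feasibility (DRF) meta-algorithm with $\epsilon$-SMD used to update $x_t$ (see context), where the per-iteration sample size $K$ satisfies the approximation condition with parameters $C_K\in(0,\frac13)$ and $\nu_1\in(0,1)$; that is, with probability at least $1-\nu_1$, $$|\hat f_t^i(x)-f_t^i(x)|\le\frac{C_K\epsilon}{2}\quad\forall x\in X,\ i\in[m],\ t\in[\tilde T].$$ Let $w(\Omega)$, $\mathcal{R}_x$ and $\mathcal{R}_p^i$ ($i\in[m]$) be the functions from the high-probability convergence assumption given in the context. Suppose $\tilde T$ satisfies $$w(\Omega)\Big(\mathcal{R}_x(\tilde T)+\max_{i\in[m]}\mathcal{R}_p^i(\tilde T)\Big)+C_K\epsilon\le(1-2C_K)\epsilon,$$ and let $\kappa^{\bullet}=w(\Omega)\mathcal{R}_x(\tilde T)/\epsilon+C_K$. Then the efficient feasibility testing algorithm (see context) returns either an $\epsilon$-feasible solution or an infeasibility certificate of the DRF problem, with probability at least $1-\nu_1$. That is, with probability at least $1-\nu_1$: if it returns $\bar x_{\tilde T}$, then $\sup_{p\in\mathcal{P}}\phi(\bar x_{\tilde T},p)\le\epsilon$; and if it returns "Infeasible", then $\inf_{x\in X}\sup_{p\in\mathcal{P}}\phi(x,p)>0$.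
   Context: Setting: $[m]=\{1,\dots,m\}$; $\Delta_k=\{q\in\mathbb{R}_+^k:\sum_r q^{(r)}=1\}$. $X\subseteq\mathbb{R}^d$ is closed and convex. For each $i\in[m]$, the functions $F_r^i:X\to\mathbb{R}$, $r\in[n]$, are convex and $G$-Lipschitz, with $|F_r^i(x)|\le M^i$ on $X$; $\mathbf{F}^i(x)=(F_1^i(x),\dots,F_n^i(x))$. Each ambiguity set $\mathcal{P}^i\subseteq\Delta_n$ is convex and compact, $\mathcal{P}=\mathcal{P}^1\times\cdots\times\mathcal{P}^m$, $\phi(x,p)=\max_{i\in[m]}(p^i)^\top\mathbf{F}^i(x)$, and $f_t^i(x)=(p_t^i)^\top\mathbf{F}^i(x)$. DRF problem (with tolerance $\epsilon$): decide between "$\epsilon$-feasible": $\inf_{x\in X}\sup_{p\in\mathcal{P}}\phi(x,p)\le\epsilon$, and "infeasible": $\inf_{x\in X}\sup_{p\in\mathcal{P}}\phi(x,p)>0$. A point $x\in X$ is an $\epsilon$-feasible solution if $\sup_{p\in\mathcal{P}}\phi(x,p)\le\epsilon$. Regret terms, for weights $\theta\in\Delta_T$: $$\epsilon^{\bullet}=\sum_{t=1}^T\theta_t\phi(x_t,p_t)-\inf_{x\in X}\sum_{t=1}^T\theta_t\phi(x,p_t),\qquad \epsilon^{i}=\sup_{p^i\in\mathcal{P}^i}\sum_{t=1}^T\theta_t(p^i)^\top\mathbf{F}^i(x_t)-\sum_{t=1}^T\theta_t(p_t^i)^\top\mathbf{F}^i(x_t).$$ Meta-algorithm: from $x_1\in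 X$, $p_1\in\mathcal{P}$ and weights $\theta\in\Delta_{\tilde T}$, for $t=1,\dots,\tilde T-1$ the variable $p_{t+1}^i\in\mathcal{P}^i$ is produced from $\{x_s,p_s\}_{s=1}^t$ by a stochastic first-order method $\mathcal{A}_p^i$ for each $i\in[m]$, and $x_{t+1}\in X$ is produced by $\epsilon$-SMD. At the end $\bar x_{\tilde T}=\sum_{t=1}^{\tilde T}\theta_t x_t$ is formed and the feasibility test is run. High-probability convergence assumption: there exist an increasing and sublinear function $w:\mathbb{R}_+\to\mathbb{R}_+$ and decreasing functions $\mathcal{R}_x(T)$, $\mathcal{R}_p^i(T)$ such that $$\mathbb{P}\big(\epsilon^{\bullet}>w(\Omega)\mathcal{R}_x(T)+\bar\epsilon\big)\le 2\exp(-\Omega),\qquad \mathbb{P}\big(\epsilon^{i}>w(\Omega)\mathcal{R}_p^i(T)\big)\le 2\exp(-\Omega)\quad\forall i\in[m],$$ where for $\epsilon$-SMD $\bar\epsilon=C_K\epsilon$. (For $\epsilon$-SMD with step size $\alpha_{x,t}=c_x/\sqrt t$, $c_x=\frac1G\sqrt{D_x/\Omega}$, and $\theta$ the normalized step sizes, one can take $w(\Omega)=3\sqrt\Omega$ for $\Omega\ge1$ and $\mathcal{R}_x(T)=G\ln(T)\sqrt{2D_x}/\sqrt T$, the first bound then holding conditionally on the event that the inequality in the approximation condition holds.) $\epsilon$-SMD update: let $\psi_x:X\to\mathbb{R}$ be differentiable and 1-strongly convex, with Bregman distance $B_{\psi_x}(x,y)=\psi_x(x)-\psi_x(y)-\nabla\psi_x(y)^\top(x-y)$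 and $D_x=\max_{x,y\in X}B_{\psi_x}(x,y)<\infty$. At iteration $t$, for each $i\in[m]$ draw i.i.d. indices $s_1,\dots,s_K\in[n]$ from $p_t^i$ and set $\hat f_t^i(x)=\frac1K\sum_{k=1}^K F_{s_k}^i(x)$. Take $\hat i_t\in\operatorname{argmax}_{i\in[m]}\hat f_t^i(x_t)$, sample $I_{x,t}\sim p_t^{\hat i_t}$, take $g_{x,t}\in\partial F_{I_{x,t}}^{\hat i_t}(x_t)$, and set $x_{t+1}=\operatorname{argmin}_{x\in X}\{g_{x,t}^\top(x-x_t)+\frac1{\alpha_{x,t}}B_{\psi_x}(x,x_t)\}$ with step size $\alpha_{x,t}>0$. Efficient feasibility testing algorithm: compute $\hat\vartheta=\max_{i\in[m]}\sum_{t=1}^{\tilde T}\theta_t\hat f_t^i(x_t)$; if $\hat\vartheta>(\kappa^{\bullet}+C_K)\epsilon$ return "Infeasible", otherwise return $\bar x_{\tilde T}$.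
   Formalization: "With probability at least 1-ν₁" is false as printed, since the regret bounds may fail; proved instead: with probability ≥ 1-ν₁, the answer is correct if all regret bounds hold, and it is correct unconditionally with probability ≥ 1-ν₁-2(m+1)exp(-Ω). *)

theory Defs
  imports "HOL-Probability.Probability" "HOL-Library.Landau_Symbols"
begin

section \<open>Distributionally robust feasibility\<close>

text \<open>
  The index sets [m] and [n] are finite types 'm and 'n.  A point p of the product of the ambiguity
  sets is a function from 'm to \<real>^'n.  Functions on X are total functions, used on X only.
\<close>

definition prob_simplex :: "(real^'n::finite) set" where
  "prob_simplex = {q. (\<forall>r. 0 \<le> q $ r) \<and> (\<Sum>r\<in>UNIV. q $ r) = 1}"

definition weight_simplex :: "nat \<Rightarrow> (nat \<Rightarrow> real) set" where
  "weight_simplex T = {\<theta>. (\<forall>t\<in>{1..T}. 0 \<le> \<theta> t) \<and> (\<Sum>t=1..T. \<theta> t) = 1}"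

definition Fvec :: "('m \<Rightarrow> 'n::finite \<Rightarrow> 'a \<Rightarrow> real) \<Rightarrow> 'm \<Rightarrow> 'a \<Rightarrow> real^'n" where
  "Fvec F i y = (\<chi> r. F i r y)"

definition phi :: "('m::finite \<Rightarrow> 'n::finite \<Rightarrow> 'a \<Rightarrow> real) \<Rightarrow> 'a \<Rightarrow> ('m \<Rightarrow> real^'n) \<Rightarrow> real" where
  "phi F y p = (MAX i. p i \<bullet> Fvec F i y)"

definition ambiguity :: "('m \<Rightarrow> (real^'n::finite) set) \<Rightarrow> ('m \<Rightarrow> real^'n) set" where
  "ambiguity P = {p. \<forall>i. p i \<in> P i}"

definition eps_feasible_solution ::
  "'a set \<Rightarrow> ('m::finite \<Rightarrow> 'n::finite \<Rightarrow> 'a \<Rightarrow> real) \<Rightarrow> ('m \<Rightarrow> (real^'n) set) \<Rightarrow> real \<Rightarrow> 'a \<Rightarrow> bool" where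
  "eps_feasible_solution X F P \<epsilon> y \<longleftrightarrow> y \<in> X \<and> (SUP p\<in>ambiguity P. phi F y p) \<le> \<epsilon>"

definition drf_infeasible ::
  "'a set \<Rightarrow> ('m::finite \<Rightarrow> 'n::finite \<Rightarrow> 'a \<Rightarrow> real) \<Rightarrow> ('m \<Rightarrow> (real^'n) set) \<Rightarrow> bool" where
  "drf_infeasible X F P \<longleftrightarrow> (INF y\<in>X. SUP p\<in>ambiguity P. phi F y p) > 0"

locale drf_problem =
  fixes X :: "(real^'d::finite) set"
    and F :: "'m::finite \<Rightarrow> 'n::finite \<Rightarrow> real^'d \<Rightarrow> real"
    and G :: real
    and Mbd :: "'m \<Rightarrow> real"
    and P :: "'m \<Rightarrow> (real^'n) set"
  assumes closed_X: "closed X"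
    and convex_X: "convex X"
    and convex_F: "\<And>i r. convex_on X (F i r)"
    and lipschitz_F: "\<And>i r. G-lipschitz_on X (F i r)"
    and bound_F: "\<And>i r y. y \<in> X \<Longrightarrow> \<bar>F i r y\<bar> \<le> Mbd i"
    and P_simplex: "\<And>i. P i \<subseteq> prob_simplex"
    and convex_P: "\<And>i. convex (P i)"
    and compact_P: "\<And>i. compact (P i)"

section \<open>Regret terms\<close>

text \<open>Here xs and ps are one realisation of the iterates, indexed by 1, \<dots>, T.\<close>

definition regret_x ::
  "'a set \<Rightarrow> ('m::finite \<Rightarrow> 'n::finite \<Rightarrow> 'a \<Rightarrow> real) \<Rightarrow> nat \<Rightarrow> (nat \<Rightarrow> real)
    \<Rightarrow> (nat \<Rightarrow> 'a) \<Rightarrow> (nat \<Rightarrow> 'm \<Rightarrow> real^'n) \<Rightarrow> real" where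
  "regret_x X F T \<theta> xs ps =
     (\<Sum>t=1..T. \<theta> t * phi F (xs t) (ps t)) - (INF y\<in>X. \<Sum>t=1..T. \<theta> t * phi F y (ps t))"

definition regret_p ::
  "('m \<Rightarrow> 'n::finite \<Rightarrow> 'a \<Rightarrow> real) \<Rightarrow> ('m \<Rightarrow> (real^'n) set) \<Rightarrow> nat \<Rightarrow> (nat \<Rightarrow> real)
    \<Rightarrow> (nat \<Rightarrow> 'a) \<Rightarrow> (nat \<Rightarrow> 'm \<Rightarrow> real^'n) \<Rightarrow> 'm \<Rightarrow> real" where
  "regret_p F P T \<theta> xs ps i =
     (SUP q\<in>P i. \<Sum>t=1..T. \<theta> t * (q \<bullet> Fvec F i (xs t)))
       - (\<Sum>t=1..T. \<theta> t * (ps t i \<bullet> Fvec F i (xs t)))"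

section \<open>Stochastic mirror descent with sampled index selection\<close>

definition strongly_convex_on :: "'a::real_normed_vector set \<Rightarrow> real \<Rightarrow> ('a \<Rightarrow> real) \<Rightarrow> bool" where
  "strongly_convex_on X \<mu> \<psi> \<longleftrightarrow>
     (\<forall>y\<in>X. \<forall>z\<in>X. \<forall>u\<in>{0..1}.
        \<psi> (u *\<^sub>R y + (1 - u) *\<^sub>R z)
          \<le> u * \<psi> y + (1 - u) * \<psi> z - \<mu> / 2 * u * (1 - u) * (norm (y - z))\<^sup>2)"

definition subdifferential :: "'a::real_inner set \<Rightarrow> ('a \<Rightarrow> real) \<Rightarrow> 'a \<Rightarrow> 'a set" where
  "subdifferential X f y = {g. \<forall>z\<in>X. f y + g \<bullet> (z - y) \<le> f z}"

definition bregman :: "('a::real_inner \<Rightarrow> real) \<Rightarrow> ('a \<Rightarrow> 'a) \<Rightarrow> 'a \<Rightarrow> 'a \<Rightarrow> real" where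
  "bregman \<psi> grad y z = \<psi> y - \<psi> z - grad z \<bullet> (y - z)"

definition fhat ::
  "('m \<Rightarrow> 'n \<Rightarrow> 'a \<Rightarrow> real) \<Rightarrow> nat \<Rightarrow> ('m \<Rightarrow> nat \<Rightarrow> 'n) \<Rightarrow> 'm \<Rightarrow> 'a \<Rightarrow> real" where
  "fhat F K s i y = (1 / real K) * (\<Sum>k=1..K. F i (s i k) y)"

text \<open>
  This locale describes the law of a run with T iterations.  The history before the draws of
  iteration t is the sigma-algebra \<open>Hs t\<close>; \<open>Gs t\<close> contains in addition the draws \<open>s t\<close>.  "Drawn
  from q" is a statement about conditional probabilities given the past.  The samples for a fixed i
  are conditionally i.i.d.; nothing is required of the joint law for different i.  The methods
  updating \<open>p\<close> may use fresh randomness of any kind, so that all that is required of them is that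
  the next value lies in the ambiguity set and belongs to the next history.  When X has empty
  interior the gradient of \<open>\<psi>\<close> relative to X is not unique; \<open>grad\<close> is any choice of it.
\<close>

locale drf_smd_run = prob_space M + drf_problem X F G Mbd P
  for M :: "'w measure"
    and X :: "(real^'d::finite) set"
    and F :: "'m::finite \<Rightarrow> 'n::finite \<Rightarrow> real^'d \<Rightarrow> real"
    and G :: real
    and Mbd :: "'m \<Rightarrow> real"
    and P :: "'m \<Rightarrow> (real^'n) set" +
  fixes \<psi> :: "real^'d \<Rightarrow> real"
    and grad :: "real^'d \<Rightarrow> real^'d"
    and T K :: nat
    and \<theta> \<alpha> :: "nat \<Rightarrow> real"
    and Hs Gs :: "nat \<Rightarrow> 'w measure"
    and x :: "nat \<Rightarrow> 'w \<Rightarrow> real^'d"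
    and p :: "nat \<Rightarrow> 'w \<Rightarrow> 'm \<Rightarrow> real^'n"
    and s :: "nat \<Rightarrow> 'w \<Rightarrow> 'm \<Rightarrow> nat \<Rightarrow> 'n"
    and ihat :: "nat \<Rightarrow> 'w \<Rightarrow> 'm"
    and I :: "nat \<Rightarrow> 'w \<Rightarrow> 'n"
    and g :: "nat \<Rightarrow> 'w \<Rightarrow> real^'d"
  assumes grad_psi: "\<And>y. y \<in> X \<Longrightarrow> (\<psi> has_derivative (\<lambda>h. grad y \<bullet> h)) (at y within X)"
    and strongly_convex_psi: "strongly_convex_on X 1 \<psi>"
    and bregman_bounded: "bdd_above {bregman \<psi> grad y z | y z. y \<in> X \<and> z \<in> X}"
    and T_pos: "1 \<le> T"
    and K_pos: "1 \<le> K"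
    and weights: "\<theta> \<in> weight_simplex T"
    and step_pos: "\<And>t. t \<in> {1..<T} \<Longrightarrow> 0 < \<alpha> t"
    and sub_G: "\<And>t. t \<in> {1..T} \<Longrightarrow> subalgebra M (Gs t)"
    and sub_H: "\<And>t. t \<in> {1..T} \<Longrightarrow> subalgebra (Gs t) (Hs t)"
    and sub_H_Suc: "\<And>t. t \<in> {1..<T} \<Longrightarrow> subalgebra (Hs (Suc t)) (Gs t)"
    and x_adapted: "\<And>t. t \<in> {1..T} \<Longrightarrow> x t \<in> borel_measurable (Hs t)"
    and p_adapted: "\<And>t i. t \<in> {1..T} \<Longrightarrow> (\<lambda>\<omega>. p t \<omega> i) \<in> borel_measurable (Hs t)"
    and x_init: "\<And>\<omega>. \<omega> \<in> space M \<Longrightarrow> x 1 \<omega> \<in> X"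
    and p_in: "\<And>t i \<omega>. t \<in> {1..T} \<Longrightarrow> \<omega> \<in> space M \<Longrightarrow> p t \<omega> i \<in> P i"
    and s_meas: "\<And>t i k. t \<in> {1..T} \<Longrightarrow> k \<in> {1..K} \<Longrightarrow>
        (\<lambda>\<omega>. s t \<omega> i k) \<in> measurable (Gs t) (count_space UNIV)"
    and s_iid: "\<And>t i \<sigma>. t \<in> {1..T} \<Longrightarrow>
        AE \<omega> in M. real_cond_exp M (Hs t)
            (indicator {\<omega>\<in>space M. \<forall>k\<in>{1..K}. s t \<omega> i k = \<sigma> k}) \<omega>
          = (\<Prod>k=1..K. p t \<omega> i $ \<sigma> k)"
    and ihat_meas: "\<And>t. t \<in> {1..<T} \<Longrightarrow> ihat t \<in> measurable (Gs t) (count_space UNIV)"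
    and ihat_argmax: "\<And>t \<omega>. t \<in> {1..<T} \<Longrightarrow> \<omega> \<in> space M \<Longrightarrow>
        is_arg_max (\<lambda>i. fhat F K (s t \<omega>) i (x t \<omega>)) (\<lambda>i. i \<in> UNIV) (ihat t \<omega>)"
    and I_meas: "\<And>t. t \<in> {1..<T} \<Longrightarrow> I t \<in> measurable (Hs (Suc t)) (count_space UNIV)"
    and I_law: "\<And>t r. t \<in> {1..<T} \<Longrightarrow>
        AE \<omega> in M. real_cond_exp M (Gs t) (indicator {\<omega>\<in>space M. I t \<omega> = r}) \<omega>
          = p t \<omega> (ihat t \<omega>) $ r"
    and g_subgradient: "\<And>t \<omega>. t \<in> {1..<T} \<Longrightarrow> \<omega> \<in> space M \<Longrightarrow>
        g t \<omega> \<in> subdifferential X (F (ihat t \<omega>) (I t \<omega>)) (x t \<omega>)"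
    and x_update: "\<And>t \<omega>. t \<in> {1..<T} \<Longrightarrow> \<omega> \<in> space M \<Longrightarrow>
        is_arg_min (\<lambda>y. g t \<omega> \<bullet> (y - x t \<omega>) + 1 / \<alpha> t * bregman \<psi> grad y (x t \<omega>))
          (\<lambda>y. y \<in> X) (x (Suc t) \<omega>)"

section \<open>Efficient feasibility test\<close>

datatype 'a test_result = Infeasible | Solution 'a

definition efficient_test ::
  "('m::finite \<Rightarrow> 'n \<Rightarrow> 'a::real_vector \<Rightarrow> real) \<Rightarrow> nat \<Rightarrow> nat \<Rightarrow> (nat \<Rightarrow> real) \<Rightarrow> real \<Rightarrow> real \<Rightarrow> real
    \<Rightarrow> (nat \<Rightarrow> 'a) \<Rightarrow> (nat \<Rightarrow> 'm \<Rightarrow> nat \<Rightarrow> 'n) \<Rightarrow> 'a test_result" where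
  "efficient_test F K T \<theta> \<kappa> C\<^sub>K \<epsilon> xs ss =
     (if (MAX i. \<Sum>t=1..T. \<theta> t * fhat F K (ss t) i (xs t)) > (\<kappa> + C\<^sub>K) * \<epsilon>
      then Infeasible
      else Solution (\<Sum>t=1..T. \<theta> t *\<^sub>R xs t))"

definition correct_answer ::
  "'a set \<Rightarrow> ('m::finite \<Rightarrow> 'n::finite \<Rightarrow> 'a \<Rightarrow> real) \<Rightarrow> ('m \<Rightarrow> (real^'n) set) \<Rightarrow> real
    \<Rightarrow> 'a test_result \<Rightarrow> bool" where
  "correct_answer X F P \<epsilon> res \<longleftrightarrow>
     (case res of Infeasible \<Rightarrow> drf_infeasible X F P
                | Solution y \<Rightarrow> eps_feasible_solution X F P \<epsilon> y)"

end

theory Submission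
  imports Defs
begin

text \<open>
  The argument is deterministic once three kinds of events are given: the sampled functions are
  within \<open>C\<^sub>K * \<epsilon> / 2\<close> of the true ones, the regret of the x-player is at most
  \<open>\<kappa> * \<epsilon>\<close>, and the regret of the i-th p-player is at most \<open>w \<Omega> * R\<^sub>p i T\<close>.  Everything
  rests on two inequalities that compare the weighted values
  \<open>V i = (\<Sum>t=1..T. \<theta> t * (ps t i \<bullet> Fvec F i (xs t)))\<close> with the robust problem.

  If some \<open>V i\<close> exceeds the regret of the x-player, the problem is infeasible: since the weights are
  nonnegative and \<open>phi\<close> is a maximum, \<open>V i\<close> is at most \<open>\<Sum>t. \<theta> t * phi F (xs t) (ps t)\<close>, so the
  regret leaves a positive lower bound on \<open>\<Sum>t. \<theta> t * phi F y (ps t)\<close> that is uniform in y; this sum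
  averages quantities at most the worst case over the ambiguity set
  (\<open>drf_infeasible_if_value_exceeds_regret\<close>).  Conversely, convexity in x bounds \<open>q \<bullet> Fvec F i\<close> at
  the averaged iterate by the average over the iterates, which the regret of the i-th p-player bounds by
  \<open>V i\<close> plus that regret (\<open>eps_feasible_average_if_values_small\<close>).  The test replaces \<open>V i\<close> by its
  estimate, which costs \<open>C\<^sub>K * \<epsilon> / 2\<close> on either side, and the threshold
  \<open>(\<kappa> + C\<^sub>K) * \<epsilon>\<close> together with the condition on the horizon leaves room for this
  (\<open>efficient_test_correct\<close>).

  The probabilistic part is an inclusion of events for the first bound and a union bound for the
  second.  Monotonicity and subadditivity of the probability need the regrets and the correctness of
  the answer to be measurable, since the measure of a non-measurable set is 0 by convention.
  The infima and suprema in the regrets range over uncountable sets; they are measurable because they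
  can be taken over a countable dense subset (\<open>borel_measurable_SUP_closed\<close>).  The set
  of \<open>\<epsilon>\<close>-feasible points is closed.
\<close>

section \<open>Measurability of suprema over closed sets\<close>

lemma closed_countable_dense:
  fixes S :: "'a::euclidean_space set"
  assumes "closed S"
  obtains D where "countable D" "D \<subseteq> S" "closure D = S"
proof -
  obtain D where D: "countable D" "D \<subseteq> S" "S \<subseteq> closure D"
    using separable by blast
  with assms show ?thesis
    by (intro that[of D]) (auto dest: closure_minimal)
qed

lemma SUP_closure_eq:
  fixes f :: "'a::metric_space \<Rightarrow> real"
  assumes cont: "continuous_on (closure D) f" and "D \<noteq> {}" and bdd: "bdd_above (f ` closure D)"
  shows "(SUP y\<in>closure D. f y) = (SUP y\<in>D. f y)"
proof (rule antisym)
  have bddD: "bdd_above (f ` D)"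
    using bdd by (rule bdd_above_mono) (use closure_subset in auto)
  show "(SUP y\<in>closure D. f y) \<le> (SUP y\<in>D. f y)"
  proof (rule cSUP_least)
    show "closure D \<noteq> {}" using assms(2) by simp
    fix y assume "y \<in> closure D"
    then show "f y \<le> (SUP y\<in>D. f y)"
      by (rule continuous_le_on_closure[OF cont]) (rule cSUP_upper[OF _ bddD])
  qed
  show "(SUP y\<in>D. f y) \<le> (SUP y\<in>closure D. f y)"
    using assms(2) bdd closure_subset by (intro cSUP_subset_mono) auto
qed

text \<open>
  For continuous \<open>h \<omega>\<close> the supremum over S equals the supremum over a countable dense subset of S,
  and countable suprema of measurable functions are measurable.
\<close>

lemma borel_measurable_SUP_closed:
  fixes h :: "'w \<Rightarrow> 'a::euclidean_space \<Rightarrow> real"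
  assumes "closed S" "S \<noteq> {}"
    and cont: "\<And>\<omega>. \<omega> \<in> space M \<Longrightarrow> continuous_on S (h \<omega>)"
    and bdd: "\<And>\<omega>. \<omega> \<in> space M \<Longrightarrow> bdd_above (h \<omega> ` S)"
    and meas: "\<And>y. y \<in> S \<Longrightarrow> (\<lambda>\<omega>. h \<omega> y) \<in> borel_measurable M"
  shows "(\<lambda>\<omega>. SUP y\<in>S. h \<omega> y) \<in> borel_measurable M"
proof -
  obtain D where D: "countable D" "D \<subseteq> S" "closure D = S"
    using closed_countable_dense[OF assms(1)] .
  then have "D \<noteq> {}" using assms(2) by auto
  have "(\<lambda>\<omega>. SUP y\<in>D. h \<omega> y) \<in> borel_measurable M"
    using D meas by (intro borel_measurable_cSUP bdd_above_mono[OF bdd]) auto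
  moreover have "(SUP y\<in>S. h \<omega> y) = (SUP y\<in>D. h \<omega> y)" if "\<omega> \<in> space M" for \<omega>
    using SUP_closure_eq[of D "h \<omega>"] cont bdd D \<open>D \<noteq> {}\<close> that by simp
  ultimately show ?thesis
    by (simp cong: measurable_cong)
qed

lemma borel_measurable_INF_closed:
  fixes h :: "'w \<Rightarrow> 'a::euclidean_space \<Rightarrow> real"
  assumes "closed S" "S \<noteq> {}"
    and cont: "\<And>\<omega>. \<omega> \<in> space M \<Longrightarrow> continuous_on S (h \<omega>)"
    and bdd: "\<And>\<omega>. \<omega> \<in> space M \<Longrightarrow> bdd_below (h \<omega> ` S)"
    and meas: "\<And>y. y \<in> S \<Longrightarrow> (\<lambda>\<omega>. h \<omega> y) \<in> borel_measurable M"
  shows "(\<lambda>\<omega>. INF y\<in>S. h \<omega> y) \<in> borel_measurable M"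
proof -
  have "(\<lambda>\<omega>. SUP y\<in>S. - h \<omega> y) \<in> borel_measurable M"
  proof (rule borel_measurable_SUP_closed[OF assms(1,2)])
    fix \<omega> assume "\<omega> \<in> space M"
    then show "continuous_on S (\<lambda>y. - h \<omega> y)" using cont by (intro continuous_intros)
    show "bdd_above ((\<lambda>y. - h \<omega> y) ` S)"
      using bdd[OF \<open>\<omega> \<in> space M\<close>] bdd_above_uminus[of "h \<omega> ` S"] by (simp add: image_image)
  qed (use meas in simp)
  then have "(\<lambda>\<omega>. - (SUP y\<in>S. - h \<omega> y)) \<in> borel_measurable M" by simp
  then show ?thesis by (simp add: Inf_real_def image_image)
qed

lemma continuous_on_MAX:
  fixes f :: "'i \<Rightarrow> 'a::topological_space \<Rightarrow> real"
  assumes "finite J" "J \<noteq> {}" "\<And>i. i \<in> J \<Longrightarrow> continuous_on S (f i)"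
  shows "continuous_on S (\<lambda>y. MAX i\<in>J. f i y)"
  using assms
proof (induction J rule: finite_ne_induct)
  case (insert i J)
  then have "continuous_on S (\<lambda>y. max (f i y) (MAX i\<in>J. f i y))"
    by (intro continuous_on_max) auto
  then show ?case using insert by simp
qed simp

section \<open>The robust constraint functions\<close>

context drf_problem
begin

lemma inner_Fvec: "q \<bullet> Fvec F i y = (\<Sum>r\<in>UNIV. q $ r * F i r y)"
  by (simp add: inner_vec_def Fvec_def)

lemma P_nonneg: "q \<in> P i \<Longrightarrow> 0 \<le> q $ r"
  and P_sum: "q \<in> P i \<Longrightarrow> (\<Sum>r\<in>UNIV. q $ r) = 1"
  using P_simplex[of i] by (auto simp: prob_simplex_def)

lemma abs_inner_Fvec_le:
  assumes "q \<in> P i" "y \<in> X"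
  shows "\<bar>q \<bullet> Fvec F i y\<bar> \<le> Mbd i"
proof -
  have "\<bar>q \<bullet> Fvec F i y\<bar> \<le> (\<Sum>r\<in>UNIV. \<bar>q $ r * F i r y\<bar>)"
    unfolding inner_Fvec by (rule sum_abs)
  also have "\<dots> \<le> (\<Sum>r\<in>UNIV. q $ r * Mbd i)"
    using assms by (intro sum_mono) (auto simp: abs_mult P_nonneg intro!: mult_left_mono bound_F)
  also have "\<dots> = Mbd i"
    using P_sum[OF assms(1)] by (simp flip: sum_distrib_right)
  finally show ?thesis .
qed

lemma continuous_F: "continuous_on X (F i r)"
  using lipschitz_on_continuous_on[OF lipschitz_F] .

lemma continuous_inner_Fvec: "continuous_on X (\<lambda>y. q \<bullet> Fvec F i y)"
  unfolding inner_Fvec by (intro continuous_intros continuous_F)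

lemma continuous_phi: "continuous_on X (\<lambda>y. phi F y q)"
  unfolding phi_def by (intro continuous_on_MAX continuous_inner_Fvec) auto

lemma convex_inner_Fvec:
  assumes "q \<in> P i"
  shows "convex_on X (\<lambda>y. q \<bullet> Fvec F i y)"
proof -
  have "convex_on X (\<lambda>y. \<Sum>r\<in>R. q $ r * F i r y)" if "finite R" for R
    using that
  proof (induction R rule: finite_induct)
    case empty
    then show ?case using convex_X by (simp add: convex_on_def)
  next
    case (insert r R)
    have "convex_on X (\<lambda>y. q $ r * F i r y)"
      using convex_on_cmul[OF P_nonneg[OF assms] convex_F] .
    with insert show ?case by (simp add: convex_on_add)
  qed
  then show ?thesis unfolding inner_Fvec by simp
qed

lemma inner_le_phi: "q i \<bullet> Fvec F i y \<le> phi F y q"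
  unfolding phi_def by (rule Max_ge) auto

lemma phi_le_iff: "phi F y q \<le> c \<longleftrightarrow> (\<forall>i. q i \<bullet> Fvec F i y \<le> c)"
  unfolding phi_def by simp

lemma phi_upper:
  assumes "q \<in> ambiguity P" "y \<in> X"
  shows "phi F y q \<le> (MAX i. Mbd i)"
proof -
  have "q i \<bullet> Fvec F i y \<le> (MAX i. Mbd i)" for i
  proof -
    have "q i \<bullet> Fvec F i y \<le> Mbd i"
      using abs_inner_Fvec_le[of "q i" i y] assms by (auto simp: ambiguity_def)
    also have "\<dots> \<le> (MAX i. Mbd i)" by (rule Max_ge) auto
    finally show ?thesis .
  qed
  then show ?thesis by (simp add: phi_le_iff)
qed

lemma phi_lower:
  assumes "q \<in> ambiguity P" "y \<in> X"
  shows "- Mbd i \<le> phi F y q"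
proof -
  have "- Mbd i \<le> q i \<bullet> Fvec F i y"
    using abs_inner_Fvec_le[of "q i" i y] assms by (auto simp: ambiguity_def)
  then show ?thesis using inner_le_phi[of q i y] by simp
qed

lemma bdd_above_phi: "y \<in> X \<Longrightarrow> bdd_above (phi F y ` ambiguity P)"
  using phi_upper by (intro bdd_aboveI2)

lemma phi_le_worst_case:
  "q \<in> ambiguity P \<Longrightarrow> y \<in> X \<Longrightarrow> phi F y q \<le> (SUP q\<in>ambiguity P. phi F y q)"
  using bdd_above_phi by (intro cSUP_upper)

text \<open>
  An intersection of closed sublevel sets, one for each value of the uncertain parameter.
\<close>

lemma closed_eps_feasible:
  assumes "ambiguity P \<noteq> {}"
  shows "closed {y. eps_feasible_solution X F P c y}"
proof -
  have "eps_feasible_solution X F P c y \<longleftrightarrow> y \<in> (\<Inter>q\<in>ambiguity P. {y\<in>X. phi F y q \<le> c})" for y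
  proof (cases "y \<in> X")
    case True
    then show ?thesis
      using cSUP_le_iff[OF assms bdd_above_phi] by (simp add: eps_feasible_solution_def)
  next
    case False
    then show ?thesis using assms by (simp add: eps_feasible_solution_def)
  qed
  then have "{y. eps_feasible_solution X F P c y}
      = (\<Inter>q\<in>ambiguity P. {y\<in>X. phi F y q \<le> c})"
    by blast
  moreover have "closed (\<Inter>q\<in>ambiguity P. {y\<in>X. phi F y q \<le> c})"
    by (intro closed_INT ballI continuous_on_closed_Collect_le continuous_phi continuous_on_const
        closed_X)
  ultimately show ?thesis by simp
qed

section \<open>Regret bounds and the robust problem\<close>

lemma weights_nonneg: "\<theta> \<in> weight_simplex T \<Longrightarrow> t \<in> {1..T} \<Longrightarrow> 0 \<le> \<theta> t"
  and weights_sum: "\<theta> \<in> weight_simplex T \<Longrightarrow> (\<Sum>t=1..T. \<theta> t) = 1"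
  by (simp_all add: weight_simplex_def)

lemma weighted_const: "\<theta> \<in> weight_simplex T \<Longrightarrow> (\<Sum>t=1..T. \<theta> t * c) = c"
  using weights_sum[of \<theta> T] by (simp flip: sum_distrib_right)

text \<open>
  A bound uniform in y: it makes the infimum in the regret of the x-player a true lower bound, whereas
  the infimum of a set of reals that is unbounded below has no specified value.
\<close>

lemma weighted_phi_lower:
  assumes \<theta>: "\<theta> \<in> weight_simplex T" and ps: "\<And>t. t \<in> {1..T} \<Longrightarrow> ps t \<in> ambiguity P"
    and "y \<in> X"
  shows "- Mbd i \<le> (\<Sum>t=1..T. \<theta> t * phi F y (ps t))"
proof -
  have "- Mbd i = (\<Sum>t=1..T. \<theta> t * (- Mbd i))"
    using weighted_const[OF \<theta>] by (rule sym)
  also have "\<dots> \<le> (\<Sum>t=1..T. \<theta> t * phi F y (ps t))"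
    by (intro sum_mono mult_left_mono phi_lower weights_nonneg[OF \<theta>] ps \<open>y \<in> X\<close>)
  finally show ?thesis .
qed

text \<open>
  Playing against the averaged sequence \<open>ps\<close> is never worse for the minimiser than playing against the
  worst case, so any positive uniform lower bound on the averaged value certifies infeasibility.
\<close>

lemma drf_infeasible_if_value_exceeds_regret:
  assumes \<theta>: "\<theta> \<in> weight_simplex T"
    and xs: "\<And>t. t \<in> {1..T} \<Longrightarrow> xs t \<in> X" and ps: "\<And>t. t \<in> {1..T} \<Longrightarrow> ps t \<in> ambiguity P"
    and "X \<noteq> {}"
    and regret: "regret_x X F T \<theta> xs ps \<le> b"
    and val: "b < (\<Sum>t=1..T. \<theta> t * (ps t i \<bullet> Fvec F i (xs t)))"
  shows "drf_infeasible X F P"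
proof -
  let ?V = "\<Sum>t=1..T. \<theta> t * (ps t i \<bullet> Fvec F i (xs t))"
  note nonneg = weights_nonneg[OF \<theta>]
  have "?V \<le> (\<Sum>t=1..T. \<theta> t * phi F (xs t) (ps t))"
    by (intro sum_mono mult_left_mono inner_le_phi nonneg)
  with regret have inf: "?V - b \<le> (INF y\<in>X. \<Sum>t=1..T. \<theta> t * phi F y (ps t))"
    unfolding regret_x_def by linarith
  have "?V - b \<le> (INF y\<in>X. SUP q\<in>ambiguity P. phi F y q)"
  proof (rule cINF_greatest[OF \<open>X \<noteq> {}\<close>])
    fix y assume y: "y \<in> X"
    let ?W = "SUP q\<in>ambiguity P. phi F y q"
    have "bdd_below ((\<lambda>y. \<Sum>t=1..T. \<theta> t * phi F y (ps t)) ` X)"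
      using weighted_phi_lower[OF \<theta> ps] by (intro bdd_belowI2)
    then have "?V - b \<le> (\<Sum>t=1..T. \<theta> t * phi F y (ps t))"
      by (rule order_trans[OF inf cINF_lower[OF _ y]])
    also have "\<dots> \<le> (\<Sum>t=1..T. \<theta> t * ?W)"
      by (intro sum_mono mult_left_mono nonneg phi_le_worst_case ps y)
    also have "\<dots> = ?W"
      by (rule weighted_const[OF \<theta>])
    finally show "?V - b \<le> ?W" .
  qed
  with val show ?thesis by (simp add: drf_infeasible_def)
qed

lemma bdd_above_weighted_inner:
  assumes \<theta>: "\<theta> \<in> weight_simplex T" and xs: "\<And>t. t \<in> {1..T} \<Longrightarrow> xs t \<in> X"
  shows "bdd_above ((\<lambda>q. \<Sum>t=1..T. \<theta> t * (q \<bullet> Fvec F i (xs t))) ` P i)"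
proof (rule bdd_aboveI2)
  fix q assume "q \<in> P i"
  then have "q \<bullet> Fvec F i (xs t) \<le> Mbd i" if "t \<in> {1..T}" for t
    using abs_inner_Fvec_le xs[OF that] abs_le_D1 by blast
  then show "(\<Sum>t=1..T. \<theta> t * (q \<bullet> Fvec F i (xs t))) \<le> (\<Sum>t=1..T. \<theta> t * Mbd i)"
    by (intro sum_mono mult_left_mono weights_nonneg[OF \<theta>])
qed

text \<open>
  By Jensen's inequality the averaged iterate does at least as well against any fixed q as the
  iterates do on average, and the regret of the i-th p-player compares that average with the values
  actually obtained.
\<close>

lemma eps_feasible_average_if_values_small:
  assumes \<theta>: "\<theta> \<in> weight_simplex T"
    and xs: "\<And>t. t \<in> {1..T} \<Longrightarrow> xs t \<in> X"
    and "ambiguity P \<noteq> {}"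
    and val: "\<And>i. (\<Sum>t=1..T. \<theta> t * (ps t i \<bullet> Fvec F i (xs t))) + regret_p F P T \<theta> xs ps i \<le> c"
  shows "eps_feasible_solution X F P c (\<Sum>t=1..T. \<theta> t *\<^sub>R xs t)"
proof -
  let ?x = "\<Sum>t=1..T. \<theta> t *\<^sub>R xs t"
  note nonneg = weights_nonneg[OF \<theta>]
  note one = weights_sum[OF \<theta>]
  then have "{1..T} \<noteq> {}" by (metis sum.empty zero_neq_one)
  have "?x \<in> X"
    using one nonneg xs by (intro convex_sum convex_X) auto
  have "phi F ?x q \<le> c" if "q \<in> ambiguity P" for q
    unfolding phi_le_iff
  proof
    fix i
    have q: "q i \<in> P i" using that by (simp add: ambiguity_def)
    have "q i \<bullet> Fvec F i ?x \<le> (\<Sum>t=1..T. \<theta> t * (q i \<bullet> Fvec F i (xs t)))"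
      using \<open>{1..T} \<noteq> {}\<close> one nonneg xs
      by (intro convex_on_sum[OF _ _ convex_inner_Fvec[OF q]]) auto
    also have "\<dots> \<le> (SUP q\<in>P i. \<Sum>t=1..T. \<theta> t * (q \<bullet> Fvec F i (xs t)))"
      using bdd_above_weighted_inner[OF \<theta> xs] q by (rule cSUP_upper[rotated])
    also have "\<dots> \<le> c" using val[of i] by (simp add: regret_p_def)
    finally show "q i \<bullet> Fvec F i ?x \<le> c" .
  qed
  with \<open>?x \<in> X\<close> \<open>ambiguity P \<noteq> {}\<close> show ?thesis
    by (auto simp: eps_feasible_solution_def intro: cSUP_least)
qed

text \<open>
  The error budget.  When the test reports infeasibility, some true value exceeds
  \<open>\<kappa> * \<epsilon> + C\<^sub>K * \<epsilon> / 2\<close>, hence the regret of the x-player.  When it does not, every true value is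
  at most \<open>\<kappa> * \<epsilon> + 3 / 2 * C\<^sub>K * \<epsilon>\<close>; adding the regret bound b of the p-players gives at most
  \<open>(1 - C\<^sub>K / 2) * \<epsilon>\<close>, because the last hypothesis keeps \<open>2 * C\<^sub>K * \<epsilon>\<close> in reserve.
\<close>

lemma efficient_test_correct:
  assumes \<theta>: "\<theta> \<in> weight_simplex T"
    and xs: "\<And>t. t \<in> {1..T} \<Longrightarrow> xs t \<in> X" and ps: "\<And>t. t \<in> {1..T} \<Longrightarrow> ps t \<in> ambiguity P"
    and X: "X \<noteq> {}" and P: "ambiguity P \<noteq> {}" and "0 < C\<^sub>K * \<epsilon>"
    and approx: "\<And>i t. t \<in> {1..T} \<Longrightarrow>
      \<bar>fhat F K (ss t) i (xs t) - ps t i \<bullet> Fvec F i (xs t)\<bar> \<le> C\<^sub>K * \<epsilon> / 2"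
    and rx: "regret_x X F T \<theta> xs ps \<le> \<kappa> * \<epsilon>"
    and rp: "\<And>i. regret_p F P T \<theta> xs ps i \<le> b"
    and budget: "\<kappa> * \<epsilon> + b \<le> (1 - 2 * C\<^sub>K) * \<epsilon>"
  shows "correct_answer X F P \<epsilon> (efficient_test F K T \<theta> \<kappa> C\<^sub>K \<epsilon> xs ss)"
proof -
  let ?V = "\<lambda>i. \<Sum>t=1..T. \<theta> t * (ps t i \<bullet> Fvec F i (xs t))"
  let ?E = "\<lambda>i. \<Sum>t=1..T. \<theta> t * fhat F K (ss t) i (xs t)"
  have err: "\<bar>?E i - ?V i\<bar> \<le> C\<^sub>K * \<epsilon> / 2" for i
  proof -
    have "\<bar>?E i - ?V i\<bar> = \<bar>\<Sum>t=1..T. \<theta> t * (fhat F K (ss t) i (xs t) - ps t i \<bullet> Fvec F i (xs t))\<bar>"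
      by (simp add: right_diff_distrib sum_subtractf)
    also have "\<dots> \<le> (\<Sum>t=1..T. \<theta> t * (C\<^sub>K * \<epsilon> / 2))"
    proof (rule order_trans[OF sum_abs], rule sum_mono)
      fix t assume t: "t \<in> {1..T}"
      show "\<bar>\<theta> t * (fhat F K (ss t) i (xs t) - ps t i \<bullet> Fvec F i (xs t))\<bar> \<le> \<theta> t * (C\<^sub>K * \<epsilon> / 2)"
        using mult_left_mono[OF approx[OF t] weights_nonneg[OF \<theta> t]] weights_nonneg[OF \<theta> t]
        by (simp add: abs_mult)
    qed
    also have "\<dots> = C\<^sub>K * \<epsilon> / 2"
      by (rule weighted_const[OF \<theta>])
    finally show ?thesis .
  qed
  show ?thesis
  proof (cases "(\<kappa> + C\<^sub>K) * \<epsilon> < (MAX i. ?E i)")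
    case True
    then obtain i where "(\<kappa> + C\<^sub>K) * \<epsilon> < ?E i"
      by (subst (asm) Max_gr_iff) auto
    then have "\<kappa> * \<epsilon> < ?V i"
      using err[of i] \<open>0 < C\<^sub>K * \<epsilon>\<close> unfolding distrib_right by linarith
    then have "drf_infeasible X F P"
      using drf_infeasible_if_value_exceeds_regret[OF \<theta> xs ps X rx] by blast
    with True show ?thesis by (simp add: correct_answer_def efficient_test_def)
  next
    case False
    then have E: "?E i \<le> (\<kappa> + C\<^sub>K) * \<epsilon>" for i by (simp add: not_less)
    have "?V i + regret_p F P T \<theta> xs ps i \<le> \<epsilon>" for i
      using E[of i] err[of i] rp[of i] budget \<open>0 < C\<^sub>K * \<epsilon>\<close>
      unfolding distrib_right left_diff_distrib by linarith
    then have "eps_feasible_solution X F P \<epsilon> (\<Sum>t=1..T. \<theta> t *\<^sub>R xs t)"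
      using eps_feasible_average_if_values_small[where xs = xs and ps = ps, OF \<theta> xs P] by blast
    with False show ?thesis by (simp add: correct_answer_def efficient_test_def)
  qed
qed

end

section \<open>Measurability of the events of a run\<close>

context drf_smd_run
begin

lemma subalgebra_Gs: "t \<in> {1..T} \<Longrightarrow> subalgebra M (Gs t)"
  and subalgebra_Hs: "t \<in> {1..T} \<Longrightarrow> subalgebra M (Hs t)"
  using sub_G[of t] sub_H[of t] unfolding subalgebra_def by auto

lemma x_measurable: "t \<in> {1..T} \<Longrightarrow> x t \<in> borel_measurable M"
  and p_measurable: "t \<in> {1..T} \<Longrightarrow> (\<lambda>\<omega>. p t \<omega> i) \<in> borel_measurable M"
  and s_measurable: "t \<in> {1..T} \<Longrightarrow> k \<in> {1..K} \<Longrightarrow>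
    (\<lambda>\<omega>. s t \<omega> i k) \<in> measurable M (count_space UNIV)"
  using measurable_from_subalg[OF subalgebra_Hs x_adapted]
    measurable_from_subalg[OF subalgebra_Hs p_adapted]
    measurable_from_subalg[OF subalgebra_Gs s_meas] by auto

lemma x_in_X:
  assumes "t \<in> {1..T}" "\<omega> \<in> space M"
  shows "x t \<omega> \<in> X"
proof (cases "t = 1")
  case False
  then have "t - 1 \<in> {1..<T}" "Suc (t - 1) = t" using assms by auto
  then show ?thesis using x_update[of "t - 1" \<omega>] assms by (simp add: is_arg_min_def)
qed (use x_init assms in simp)

lemma p_in_ambiguity: "t \<in> {1..T} \<Longrightarrow> \<omega> \<in> space M \<Longrightarrow> p t \<omega> \<in> ambiguity P"
  using p_in by (simp add: ambiguity_def)

lemma X_nonempty: "X \<noteq> {}" and ambiguity_nonempty: "ambiguity P \<noteq> {}"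
  using not_empty x_in_X[of 1] p_in_ambiguity[of 1] T_pos by fastforce+

lemma F_x_measurable:
  assumes "t \<in> {1..T}"
  shows "(\<lambda>\<omega>. F i r (x t \<omega>)) \<in> borel_measurable M"
proof -
  \<comment> \<open>Only the values of F on X are controlled, so the iterate is viewed as a map into X.\<close>
  have "x t \<in> measurable M (restrict_space borel X)"
    using x_measurable[OF assms] x_in_X[OF assms] by (intro measurable_restrict_space2) auto
  then show ?thesis
    using borel_measurable_continuous_on_restrict[OF continuous_F] by (rule measurable_compose)
qed

lemma Fvec_x_measurable:
  "t \<in> {1..T} \<Longrightarrow> (\<lambda>\<omega>. q \<bullet> Fvec F i (x t \<omega>)) \<in> borel_measurable M"
  unfolding inner_Fvec by (intro borel_measurable_sum borel_measurable_times F_x_measurable) auto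

lemma inner_p_measurable:
  "t \<in> {1..T} \<Longrightarrow> (\<lambda>\<omega>. p t \<omega> i \<bullet> v) \<in> borel_measurable M"
  using p_measurable[of t i] by simp

lemma inner_p_Fvec_x_measurable:
  assumes "t \<in> {1..T}"
  shows "(\<lambda>\<omega>. p t \<omega> i \<bullet> Fvec F i (x t \<omega>)) \<in> borel_measurable M"
proof -
  have "(\<lambda>\<omega>. p t \<omega> i $ r) \<in> borel_measurable M" for r
    using inner_p_measurable[OF assms, of i "axis r 1"] by (simp add: inner_axis)
  then show ?thesis
    unfolding inner_Fvec
    by (intro borel_measurable_sum borel_measurable_times F_x_measurable assms)
qed

text \<open>
  The random index takes finitely many values, so evaluating \<open>F i\<close> at it selects among finitely many
  measurable functions.
\<close>

lemma fhat_measurable: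
  assumes "t \<in> {1..T}"
  shows "(\<lambda>\<omega>. fhat F K (s t \<omega>) i (x t \<omega>)) \<in> borel_measurable M"
proof -
  have "(\<lambda>\<omega>. F i (s t \<omega> i k) (x t \<omega>)) \<in> borel_measurable M" if "k \<in> {1..K}" for k
    using measurable_compose_countable'[OF F_x_measurable[OF assms] s_measurable[OF assms that]]
    by simp
  then show ?thesis unfolding fhat_def by (intro borel_measurable_times borel_measurable_sum) auto
qed

lemma regret_x_measurable:
  "(\<lambda>\<omega>. regret_x X F T \<theta> (\<lambda>t. x t \<omega>) (\<lambda>t. p t \<omega>)) \<in> borel_measurable M"
proof -
  have "(\<lambda>\<omega>. INF y\<in>X. \<Sum>t=1..T. \<theta> t * phi F y (p t \<omega>)) \<in> borel_measurable M"
  proof (rule borel_measurable_INF_closed[OF closed_X X_nonempty])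
    fix \<omega> assume \<omega>: "\<omega> \<in> space M"
    show "continuous_on X (\<lambda>y. \<Sum>t=1..T. \<theta> t * phi F y (p t \<omega>))"
      by (intro continuous_intros continuous_phi)
    show "bdd_below ((\<lambda>y. \<Sum>t=1..T. \<theta> t * phi F y (p t \<omega>)) ` X)"
      using weighted_phi_lower[OF weights p_in_ambiguity[OF _ \<omega>]] by (intro bdd_belowI2)
  next
    fix y assume "y \<in> X"
    show "(\<lambda>\<omega>. \<Sum>t=1..T. \<theta> t * phi F y (p t \<omega>)) \<in> borel_measurable M"
      unfolding phi_def
      by (intro borel_measurable_sum borel_measurable_times borel_measurable_Max inner_p_measurable)
         auto
  qed
  moreover have "(\<lambda>\<omega>. \<Sum>t=1..T. \<theta> t * phi F (x t \<omega>) (p t \<omega>)) \<in> borel_measurable M"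
    unfolding phi_def
    by (intro borel_measurable_sum borel_measurable_times borel_measurable_Max
        inner_p_Fvec_x_measurable) auto
  ultimately show ?thesis
    unfolding regret_x_def by (intro borel_measurable_diff)
qed

lemma regret_p_measurable:
  "(\<lambda>\<omega>. regret_p F P T \<theta> (\<lambda>t. x t \<omega>) (\<lambda>t. p t \<omega>) i) \<in> borel_measurable M"
proof -
  have "P i \<noteq> {}" using ambiguity_nonempty by (auto simp: ambiguity_def)
  have "(\<lambda>\<omega>. SUP q\<in>P i. \<Sum>t=1..T. \<theta> t * (q \<bullet> Fvec F i (x t \<omega>))) \<in> borel_measurable M"
  proof (rule borel_measurable_SUP_closed[OF compact_imp_closed[OF compact_P] \<open>P i \<noteq> {}\<close>])
    fix \<omega> assume \<omega>: "\<omega> \<in> space M"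
    show "continuous_on (P i) (\<lambda>q. \<Sum>t=1..T. \<theta> t * (q \<bullet> Fvec F i (x t \<omega>)))"
      by (intro continuous_intros)
    show "bdd_above ((\<lambda>q. \<Sum>t=1..T. \<theta> t * (q \<bullet> Fvec F i (x t \<omega>))) ` P i)"
      using bdd_above_weighted_inner[OF weights x_in_X[OF _ \<omega>]] .
  next
    fix q
    show "(\<lambda>\<omega>. \<Sum>t=1..T. \<theta> t * (q \<bullet> Fvec F i (x t \<omega>))) \<in> borel_measurable M"
      by (intro borel_measurable_sum borel_measurable_times Fvec_x_measurable) auto
  qed
  moreover have "(\<lambda>\<omega>. \<Sum>t=1..T. \<theta> t * (p t \<omega> i \<bullet> Fvec F i (x t \<omega>))) \<in> borel_measurable M"
    by (intro borel_measurable_sum borel_measurable_times inner_p_Fvec_x_measurable) auto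
  ultimately show ?thesis
    unfolding regret_p_def by (intro borel_measurable_diff)
qed

lemma correct_answer_event:
  "{\<omega>\<in>space M. correct_answer X F P \<epsilon>
      (efficient_test F K T \<theta> \<kappa> C\<^sub>K \<epsilon> (\<lambda>t. x t \<omega>) (\<lambda>t. s t \<omega>))} \<in> events"
proof -
  let ?v = "\<lambda>\<omega>. MAX i. \<Sum>t=1..T. \<theta> t * fhat F K (s t \<omega>) i (x t \<omega>)"
  let ?x = "\<lambda>\<omega>. \<Sum>t=1..T. \<theta> t *\<^sub>R x t \<omega>"
  have [measurable]: "?v \<in> borel_measurable M"
    by (intro borel_measurable_sum borel_measurable_times borel_measurable_Max fhat_measurable) auto
  have [measurable]: "?x \<in> borel_measurable M"
    by (intro borel_measurable_sum borel_measurable_scaleR x_measurable) auto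
  have [measurable]: "{y. eps_feasible_solution X F P \<epsilon> y} \<in> sets borel"
    using closed_eps_feasible[OF ambiguity_nonempty] by (rule borel_closed)
  have "correct_answer X F P \<epsilon> (efficient_test F K T \<theta> \<kappa> C\<^sub>K \<epsilon> (\<lambda>t. x t \<omega>) (\<lambda>t. s t \<omega>))
      \<longleftrightarrow> (if (\<kappa> + C\<^sub>K) * \<epsilon> < ?v \<omega> then drf_infeasible X F P
           else ?x \<omega> \<in> {y. eps_feasible_solution X F P \<epsilon> y})" for \<omega>
    by (simp add: correct_answer_def efficient_test_def)
  moreover have "{\<omega>\<in>space M. if (\<kappa> + C\<^sub>K) * \<epsilon> < ?v \<omega> then drf_infeasible X F P
           else ?x \<omega> \<in> {y. eps_feasible_solution X F P \<epsilon> y}} \<in> events"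
    by measurable
  ultimately show ?thesis by presburger
qed

end

section \<open>Correctness of the test with high probability\<close>

theorem theorem4:
  fixes M :: "'w measure"
    and X :: "(real^'d::finite) set"
    and F :: "'m::finite \<Rightarrow> 'n::finite \<Rightarrow> real^'d \<Rightarrow> real"
    and P :: "'m \<Rightarrow> (real^'n) set"
    and T K :: nat
    and \<epsilon> C\<^sub>K \<nu>\<^sub>1 \<Omega> \<kappa> :: real
    and w :: "real \<Rightarrow> real" and R\<^sub>x :: "nat \<Rightarrow> real" and R\<^sub>p :: "'m \<Rightarrow> nat \<Rightarrow> real"
  assumes run: "drf_smd_run M X F G Mbd P \<psi> grad T K \<theta> \<alpha> Hs Gs x p s ihat I g"
    and eps: "0 < \<epsilon>"
    and C: "0 < C\<^sub>K" "C\<^sub>K < 1 / 3"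
    and nu: "0 < \<nu>\<^sub>1" "\<nu>\<^sub>1 < 1"
    and approx: "\<P>(\<omega> in M. \<forall>y\<in>X. \<forall>i. \<forall>t\<in>{1..T}.
        \<bar>fhat F K (s t \<omega>) i y - p t \<omega> i \<bullet> Fvec F i y\<bar> \<le> C\<^sub>K * \<epsilon> / 2) \<ge> 1 - \<nu>\<^sub>1"
    and Omega: "0 \<le> \<Omega>"
    and w_nonneg: "\<And>u. 0 \<le> u \<Longrightarrow> 0 \<le> w u"
    and w_increasing: "mono_on {0..} w"
    and w_sublinear: "w \<in> o[at_top](\<lambda>u. u)"
    and Rx_decreasing: "antimono_on {1..} R\<^sub>x"
    and Rp_decreasing: "\<And>i. antimono_on {1..} (R\<^sub>p i)"
    and conv_x: "\<P>(\<omega> in M. regret_x X F T \<theta> (\<lambda>t. x t \<omega>) (\<lambda>t. p t \<omega>)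
          > w \<Omega> * R\<^sub>x T + C\<^sub>K * \<epsilon>) \<le> 2 * exp (- \<Omega>)"
    and conv_p: "\<And>i. \<P>(\<omega> in M. regret_p F P T \<theta> (\<lambda>t. x t \<omega>) (\<lambda>t. p t \<omega>) i
          > w \<Omega> * R\<^sub>p i T) \<le> 2 * exp (- \<Omega>)"
    and horizon: "w \<Omega> * (R\<^sub>x T + (MAX i. R\<^sub>p i T)) + C\<^sub>K * \<epsilon> \<le> (1 - 2 * C\<^sub>K) * \<epsilon>"
    and kappa: "\<kappa> = w \<Omega> * R\<^sub>x T / \<epsilon> + C\<^sub>K"
  shows "\<P>(\<omega> in M.
           regret_x X F T \<theta> (\<lambda>t. x t \<omega>) (\<lambda>t. p t \<omega>) \<le> w \<Omega> * R\<^sub>x T + C\<^sub>K * \<epsilon> \<and>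
           (\<forall>i. regret_p F P T \<theta> (\<lambda>t. x t \<omega>) (\<lambda>t. p t \<omega>) i \<le> w \<Omega> * R\<^sub>p i T)
           \<longrightarrow> correct_answer X F P \<epsilon>
                 (efficient_test F K T \<theta> \<kappa> C\<^sub>K \<epsilon> (\<lambda>t. x t \<omega>) (\<lambda>t. s t \<omega>))) \<ge> 1 - \<nu>\<^sub>1
       \<and> \<P>(\<omega> in M. correct_answer X F P \<epsilon>
                 (efficient_test F K T \<theta> \<kappa> C\<^sub>K \<epsilon> (\<lambda>t. x t \<omega>) (\<lambda>t. s t \<omega>)))
           \<ge> 1 - \<nu>\<^sub>1 - 2 * (real CARD('m) + 1) * exp (- \<Omega>)"
proof -
  interpret drf_smd_run M X F G Mbd P \<psi> grad T K \<theta> \<alpha> Hs Gs x p s ihat I g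
    by (rule run)
  let ?rx = "\<lambda>\<omega>. regret_x X F T \<theta> (\<lambda>t. x t \<omega>) (\<lambda>t. p t \<omega>)"
  let ?rp = "\<lambda>\<omega> i. regret_p F P T \<theta> (\<lambda>t. x t \<omega>) (\<lambda>t. p t \<omega>) i"
  let ?ok = "\<lambda>\<omega>. correct_answer X F P \<epsilon>
    (efficient_test F K T \<theta> \<kappa> C\<^sub>K \<epsilon> (\<lambda>t. x t \<omega>) (\<lambda>t. s t \<omega>))"
  let ?low = "\<lambda>\<omega>. ?rx \<omega> \<le> w \<Omega> * R\<^sub>x T + C\<^sub>K * \<epsilon> \<and> (\<forall>i. ?rp \<omega> i \<le> w \<Omega> * R\<^sub>p i T)"
  define A where "A = {\<omega>\<in>space M. \<forall>y\<in>X. \<forall>i. \<forall>t\<in>{1..T}.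
        \<bar>fhat F K (s t \<omega>) i y - p t \<omega> i \<bullet> Fvec F i y\<bar> \<le> C\<^sub>K * \<epsilon> / 2}"
  define B where "B = {\<omega>\<in>space M. \<not> ?low \<omega>}"
  have [measurable]: "?rx \<in> borel_measurable M" "(\<lambda>\<omega>. ?rp \<omega> i) \<in> borel_measurable M" for i
    by (rule regret_x_measurable regret_p_measurable)+
  have [measurable]: "Measurable.pred M ?ok"
    using correct_answer_event by (simp add: pred_def)

  have \<kappa>\<epsilon>: "\<kappa> * \<epsilon> = w \<Omega> * R\<^sub>x T + C\<^sub>K * \<epsilon>"
    using eps by (simp add: kappa field_simps)
  have Rp_le: "w \<Omega> * R\<^sub>p i T \<le> w \<Omega> * (MAX i. R\<^sub>p i T)" for i
    using w_nonneg[OF Omega] by (intro mult_left_mono Max_ge) auto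
  have correct: "?ok \<omega>" if "\<omega> \<in> A" "?low \<omega>" for \<omega>
  proof (rule efficient_test_correct[where b = "w \<Omega> * (MAX i. R\<^sub>p i T)"])
    have \<omega>: "\<omega> \<in> space M" using that(1) by (simp add: A_def)
    show "x t \<omega> \<in> X" "p t \<omega> \<in> ambiguity P" if "t \<in> {1..T}" for t
      using x_in_X p_in_ambiguity that \<omega> by auto
    then show "\<bar>fhat F K (s t \<omega>) i (x t \<omega>) - p t \<omega> i \<bullet> Fvec F i (x t \<omega>)\<bar> \<le> C\<^sub>K * \<epsilon> / 2"
      if "t \<in> {1..T}" for i t
      using \<open>\<omega> \<in> A\<close> that by (simp add: A_def)
    show "?rx \<omega> \<le> \<kappa> * \<epsilon>" using \<open>?low \<omega>\<close> by (simp add: \<kappa>\<epsilon>)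
    show "?rp \<omega> i \<le> w \<Omega> * (MAX i. R\<^sub>p i T)" for i
      using \<open>?low \<omega>\<close> Rp_le[of i] by (meson order_trans)
    show "\<kappa> * \<epsilon> + w \<Omega> * (MAX i. R\<^sub>p i T) \<le> (1 - 2 * C\<^sub>K) * \<epsilon>"
      using horizon by (simp add: \<kappa>\<epsilon> distrib_left)
    show "0 < C\<^sub>K * \<epsilon>" using eps C by simp
  qed (rule weights X_nonempty ambiguity_nonempty)+

  have A: "1 - \<nu>\<^sub>1 \<le> prob A" using approx by (simp add: A_def)
  have "A \<subseteq> {\<omega>\<in>space M. ?low \<omega> \<longrightarrow> ?ok \<omega>}"
    using correct by (auto simp: A_def)
  then have "prob A \<le> \<P>(\<omega> in M. ?low \<omega> \<longrightarrow> ?ok \<omega>)"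
    by (rule finite_measure_mono) measurable
  with A have first: "1 - \<nu>\<^sub>1 \<le> \<P>(\<omega> in M. ?low \<omega> \<longrightarrow> ?ok \<omega>)" by simp

  let ?Bx = "{\<omega>\<in>space M. ?rx \<omega> > w \<Omega> * R\<^sub>x T + C\<^sub>K * \<epsilon>}"
  let ?Bp = "\<lambda>i. {\<omega>\<in>space M. ?rp \<omega> i > w \<Omega> * R\<^sub>p i T}"
  have "B = ?Bx \<union> (\<Union>i. ?Bp i)"
    by (auto simp: B_def not_le)
  then have "prob B \<le> prob ?Bx + prob (\<Union>i. ?Bp i)"
    by (simp add: measure_subadditive)
  also have "prob (\<Union>i. ?Bp i) \<le> (\<Sum>i\<in>UNIV. prob (?Bp i))"
    by (rule finite_measure_subadditive_finite) auto
  also have "prob ?Bx + (\<Sum>i\<in>UNIV. prob (?Bp i))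
      \<le> 2 * exp (- \<Omega>) + (\<Sum>i\<in>(UNIV :: 'm set). 2 * exp (- \<Omega>))"
    by (intro add_mono sum_mono conv_x conv_p)
  also have "\<dots> = 2 * (real CARD('m) + 1) * exp (- \<Omega>)"
    by (simp add: algebra_simps)
  finally have B: "prob B \<le> 2 * (real CARD('m) + 1) * exp (- \<Omega>)" by simp

  have "{\<omega>\<in>space M. ?low \<omega> \<longrightarrow> ?ok \<omega>} \<subseteq> {\<omega>\<in>space M. ?ok \<omega>} \<union> B"
    by (auto simp: B_def)
  moreover have [measurable]: "B \<in> events" unfolding B_def by measurable
  ultimately have "\<P>(\<omega> in M. ?low \<omega> \<longrightarrow> ?ok \<omega>) \<le> prob ({\<omega>\<in>space M. ?ok \<omega>} \<union> B)"
    by (intro finite_measure_mono) auto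
  also have "\<dots> \<le> \<P>(\<omega> in M. ?ok \<omega>) + prob B"
    by (intro measure_subadditive) auto
  finally show ?thesis using first B by auto
qed

end
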